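(* Let $R$ be a unital ring, $M$ a unitary right $R$-module, $N\subseteq M$ a direct summand, and let $e\in\operatorname{End}_R(M)$ be an idempotent such that $e(M)=N$. The following statements are equivalent: (a) $N$ is a complemented distributive submodule of $M$. (b) $e$ is central in the ring $\operatorname{End}_R(M)$ and $e(X)\subseteq X$ for every submodule $X\subseteq M$.
   Context: A submodule $N\subseteq M$ is distributive if $(Y_1+Y_2)\cap N=(Y_1\cap N)+(Y_2\cap N)$ for all submodules $Y_1,Y_2\subseteq M$; equivalently, if $(Y_1\cap Y_2)+N=(Y_1+N)\cap(Y_2+N)$ for all submodules $Y_1,Y_2\subseteq M$. A complemented distributive submodule of $M$ is a distributive submodule that is also a direct summand of $M$. *)

theory Defs
  imports "HOL-Algebra.AbelCoset"
begin

text \<open>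
  The library's modules are left modules over commutative rings. Here the ring is an arbitrary
  unital ring and it acts on the right. The record extends the library's ring record only in order
  to inherit its additive structure; its multiplicative fields are
  never used.
\<close>

record ('a, 'b) right_module = "'b ring" +
  rsmult :: "['b, 'a] \<Rightarrow> 'b" (infixl \<open>\<odot>\<^sub>r\<index>\<close> 70)

locale right_module = R?: ring R + M?: abelian_group M
  for R :: "('a, 'r) ring_scheme" (structure)
    and M :: "('a, 'b, 'm) right_module_scheme" (structure) +
  assumes rsmult_closed [simp, intro]:
      "\<lbrakk>x \<in> carrier M; a \<in> carrier R\<rbrakk> \<Longrightarrow> x \<odot>\<^sub>r\<^bsub>M\<^esub> a \<in> carrier M"
    and rsmult_add_left:
      "\<lbrakk>x \<in> carrier M; y \<in> carrier M; a \<in> carrier R\<rbrakk> \<Longrightarrow>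
        (x \<oplus>\<^bsub>M\<^esub> y) \<odot>\<^sub>r\<^bsub>M\<^esub> a = (x \<odot>\<^sub>r\<^bsub>M\<^esub> a) \<oplus>\<^bsub>M\<^esub> (y \<odot>\<^sub>r\<^bsub>M\<^esub> a)"
    and rsmult_add_right:
      "\<lbrakk>x \<in> carrier M; a \<in> carrier R; b \<in> carrier R\<rbrakk> \<Longrightarrow>
        x \<odot>\<^sub>r\<^bsub>M\<^esub> (a \<oplus>\<^bsub>R\<^esub> b) = (x \<odot>\<^sub>r\<^bsub>M\<^esub> a) \<oplus>\<^bsub>M\<^esub> (x \<odot>\<^sub>r\<^bsub>M\<^esub> b)"
    and rsmult_assoc:
      "\<lbrakk>x \<in> carrier M; a \<in> carrier R; b \<in> carrier R\<rbrakk> \<Longrightarrow>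
        x \<odot>\<^sub>r\<^bsub>M\<^esub> (a \<otimes>\<^bsub>R\<^esub> b) = (x \<odot>\<^sub>r\<^bsub>M\<^esub> a) \<odot>\<^sub>r\<^bsub>M\<^esub> b"
    and rsmult_one [simp]:
      "x \<in> carrier M \<Longrightarrow> x \<odot>\<^sub>r\<^bsub>M\<^esub> \<one>\<^bsub>R\<^esub> = x"

locale right_submodule = subgroup N "add_monoid M"
  for N :: "'b set"
    and R :: "('a, 'r) ring_scheme"
    and M :: "('a, 'b, 'm) right_module_scheme" (structure) +
  assumes rsmult_closed: "\<lbrakk>x \<in> N; a \<in> carrier R\<rbrakk> \<Longrightarrow> x \<odot>\<^sub>r a \<in> N"

definition distributive_submodule ::
  "'b set \<Rightarrow> ('a, 'r) ring_scheme \<Rightarrow> ('a, 'b, 'm) right_module_scheme \<Rightarrow> bool" where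
  "distributive_submodule N R M \<longleftrightarrow>
     right_submodule N R M \<and>
     (\<forall>Y1 Y2. right_submodule Y1 R M \<longrightarrow> right_submodule Y2 R M \<longrightarrow>
        (Y1 <+>\<^bsub>M\<^esub> Y2) \<inter> N = (Y1 \<inter> N) <+>\<^bsub>M\<^esub> (Y2 \<inter> N))"

definition direct_summand ::
  "'b set \<Rightarrow> ('a, 'r) ring_scheme \<Rightarrow> ('a, 'b, 'm) right_module_scheme \<Rightarrow> bool" where
  "direct_summand N R M \<longleftrightarrow>
     right_submodule N R M \<and>
     (\<exists>L. right_submodule L R M \<and> N <+>\<^bsub>M\<^esub> L = carrier M \<and> N \<inter> L = {\<zero>\<^bsub>M\<^esub>})"

definition complemented_distributive_submodule ::
  "'b set \<Rightarrow> ('a, 'r) ring_scheme \<Rightarrow> ('a, 'b, 'm) right_module_scheme \<Rightarrow> bool" where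
  "complemented_distributive_submodule N R M \<longleftrightarrow>
     distributive_submodule N R M \<and> direct_summand N R M"

text \<open>
  Endomorphisms are required to be extensional (undefined off the carrier), so that equality of
  elements of the endomorphism ring is pointwise equality on the module.
\<close>

definition End_ring ::
  "('a, 'r) ring_scheme \<Rightarrow> ('a, 'b, 'm) right_module_scheme \<Rightarrow> ('b \<Rightarrow> 'b) ring" where
  "End_ring R M =
     \<lparr>carrier = {f \<in> carrier M \<rightarrow>\<^sub>E carrier M.
          (\<forall>x\<in>carrier M. \<forall>y\<in>carrier M. f (x \<oplus>\<^bsub>M\<^esub> y) = f x \<oplus>\<^bsub>M\<^esub> f y) \<and>
          (\<forall>x\<in>carrier M. \<forall>a\<in>carrier R. f (x \<odot>\<^sub>r\<^bsub>M\<^esub> a) = f x \<odot>\<^sub>r\<^bsub>M\<^esub> a)},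
      mult = (\<lambda>f g. compose (carrier M) f g),
      one = (\<lambda>x\<in>carrier M. x),
      zero = (\<lambda>x\<in>carrier M. \<zero>\<^bsub>M\<^esub>),
      add = (\<lambda>f g. \<lambda>x\<in>carrier M. f x \<oplus>\<^bsub>M\<^esub> g x)\<rparr>"

definition ring_center :: "('a, 'r) ring_scheme \<Rightarrow> 'a set" where
  "ring_center S = {z \<in> carrier S. \<forall>x\<in>carrier S. z \<otimes>\<^bsub>S\<^esub> x = x \<otimes>\<^bsub>S\<^esub> z}"

lemma (in right_module) zero_rsmult:
  assumes "a \<in> carrier R"
  shows "\<zero>\<^bsub>M\<^esub> \<odot>\<^sub>r\<^bsub>M\<^esub> a = \<zero>\<^bsub>M\<^esub>"
proof -
  have "\<zero>\<^bsub>M\<^esub> \<odot>\<^sub>r\<^bsub>M\<^esub> a \<oplus>\<^bsub>M\<^esub> \<zero>\<^bsub>M\<^esub> \<odot>\<^sub>r\<^bsub>M\<^esub> a = \<zero>\<^bsub>M\<^esub> \<odot>\<^sub>r\<^bsub>M\<^esub> a"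
    using assms rsmult_add_left[of "\<zero>\<^bsub>M\<^esub>" "\<zero>\<^bsub>M\<^esub>" a] by simp
  then show ?thesis
    using assms by (metis M.add.r_cancel_one' M.zero_closed rsmult_closed)
qed

lemma (in right_module) minus_rsmult:
  assumes "x \<in> carrier M" "a \<in> carrier R"
  shows "(\<ominus>\<^bsub>M\<^esub> x) \<odot>\<^sub>r\<^bsub>M\<^esub> a = \<ominus>\<^bsub>M\<^esub> (x \<odot>\<^sub>r\<^bsub>M\<^esub> a)"
proof -
  have "(\<ominus>\<^bsub>M\<^esub> x) \<odot>\<^sub>r\<^bsub>M\<^esub> a \<oplus>\<^bsub>M\<^esub> x \<odot>\<^sub>r\<^bsub>M\<^esub> a = \<zero>\<^bsub>M\<^esub>"
    using assms rsmult_add_left[of "\<ominus>\<^bsub>M\<^esub> x" x a] zero_rsmult by (simp add: M.l_neg)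
  then show ?thesis
    using assms by (metis M.a_inv_closed M.minus_equality rsmult_closed)
qed

lemma (in right_module) End_ring_is_ring: "ring (End_ring R M)"
proof (rule ringI)
  show "abelian_group (End_ring R M)"
  proof (rule abelian_groupI)
    fix f assume f: "f \<in> carrier (End_ring R M)"
    let ?g = "\<lambda>x\<in>carrier M. \<ominus>\<^bsub>M\<^esub> f x"
    have "?g \<in> carrier (End_ring R M)"
      using f by (auto simp: End_ring_def PiE_iff M.minus_add minus_rsmult)
    moreover have "?g \<oplus>\<^bsub>End_ring R M\<^esub> f = \<zero>\<^bsub>End_ring R M\<^esub>"
      using f by (auto simp: End_ring_def PiE_iff M.l_neg intro!: restrict_ext)
    ultimately show "\<exists>g\<in>carrier (End_ring R M). g \<oplus>\<^bsub>End_ring R M\<^esub> f = \<zero>\<^bsub>End_ring R M\<^esub>"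
      by blast
  qed (auto simp: End_ring_def PiE_iff M.a_ac rsmult_add_left zero_rsmult
         intro!: restrict_ext extensionalityI[where A = "carrier M"])
  show "monoid (End_ring R M)"
    by (rule monoidI)
       (auto simp: End_ring_def PiE_iff compose_def
         intro!: restrict_ext extensionalityI[where A = "carrier M"])
qed (auto simp: End_ring_def PiE_iff compose_def intro!: restrict_ext)

end

theory Submission
  imports Defs
begin

text \<open>
  Both conditions are equivalent to the invariance of every submodule under \<open>e\<close>. Write \<open>K\<close> for the
  kernel of \<open>e\<close>, so that every \<open>x\<close> splits as \<open>e x + (x - e x)\<close> with second part in \<open>K\<close>.

  If \<open>N\<close> is distributive and \<open>x\<close> lies in a submodule \<open>X\<close>, then \<open>e x\<close> lies in
  \<open>(X + K) \<inter> N = (X \<inter> N) + (K \<inter> N)\<close>, and this is contained in \<open>X\<close> because \<open>K \<inter> N = 0\<close>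
  (lemma \<open>distributive_image_imp_invariant\<close>). Conversely, if \<open>e\<close> preserves submodules, applying
  \<open>e\<close> to an element \<open>y\<^sub>1 + y\<^sub>2\<close> of \<open>N\<close> leaves it fixed and moves both summands into \<open>N\<close>
  (lemma \<open>invariant_imp_distributive_image\<close>).

  Centrality then comes for free. The image of an idempotent endomorphism \<open>h\<close> is a submodule, so
  its invariance under \<open>e\<close> says \<open>e h = h e h\<close>; and in any ring an idempotent with this property for
  all idempotents \<open>h\<close> is central (lemma \<open>idempotent_central\<close>).
\<close>

text \<open>
  The element \<open>a = (1 - e) f e\<close> satisfies \<open>e a = 0\<close>, \<open>a e = a\<close> and hence \<open>a\<^sup>2 = 0\<close>, so \<open>h = e + a\<close> is an
  idempotent with \<open>e h = e\<close> and \<open>h e = h\<close>. The hypothesis for this \<open>h\<close> forces \<open>e = e + a\<close>.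
\<close>

lemma (in ring) idempotent_semicentral:
  assumes e: "e \<in> carrier R" "e \<otimes> e = e"
    and inv: "\<And>h. h \<in> carrier R \<Longrightarrow> h \<otimes> h = h \<Longrightarrow> e \<otimes> h = h \<otimes> e \<otimes> h"
    and f: "f \<in> carrier R"
  shows "f \<otimes> e = e \<otimes> f \<otimes> e"
proof -
  define a where "a = f \<otimes> e \<ominus> e \<otimes> f \<otimes> e"
  have a: "a \<in> carrier R"
    using e f by (simp add: a_def)
  have "e \<otimes> (e \<otimes> f \<otimes> e) = e \<otimes> f \<otimes> e"
    using e f by (metis m_assoc m_closed)
  then have ea: "e \<otimes> a = \<zero>"
    using e f by (simp add: a_def minus_eq r_distr r_minus m_assoc r_neg)
  have ae: "a \<otimes> e = a"
    using e f by (simp add: a_def minus_eq l_distr l_minus m_assoc)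
  have aa: "a \<otimes> a = \<zero>"
    using a e ea ae by (metis m_assoc r_null)
  define h where "h = e \<oplus> a"
  have h: "h \<in> carrier R"
    using a e by (simp add: h_def)
  have he: "h \<otimes> e = h"
    using a e ae by (simp add: h_def l_distr)
  have eh: "e \<otimes> h = e"
    using a e ea by (simp add: h_def r_distr)
  have hh: "h \<otimes> h = h"
    using a e ea ae aa by (simp add: h_def l_distr r_distr)
  have "e = e \<oplus> a"
    using inv[OF h hh] eh he hh by (simp add: h_def)
  then have a0: "a = \<zero>"
    using a e add.l_cancel_one'[of e a] by simp
  have "f \<otimes> e = a \<oplus> e \<otimes> f \<otimes> e"
    using e(1) f by (simp add: a_def minus_eq a_assoc l_neg)
  also have "\<dots> = e \<otimes> f \<otimes> e"
    using e(1) f a0 by simp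
  finally show ?thesis .
qed

text \<open>
  For idempotent \<open>h\<close> the equation \<open>e h = h e h\<close> is the same for \<open>1 - e\<close> as for \<open>e\<close>. The previous
  lemma therefore applies to both, and the two results are \<open>f e = e f e\<close> and \<open>e f = e f e\<close>.
\<close>

lemma (in ring) idempotent_central:
  assumes e: "e \<in> carrier R" "e \<otimes> e = e"
    and inv: "\<And>h. h \<in> carrier R \<Longrightarrow> h \<otimes> h = h \<Longrightarrow> e \<otimes> h = h \<otimes> e \<otimes> h"
  shows "e \<in> ring_center R"
proof -
  have "e \<otimes> f = f \<otimes> e" if f: "f \<in> carrier R" for f
  proof -
    have fe: "f \<otimes> e = e \<otimes> f \<otimes> e"
      by (rule idempotent_semicentral[OF e _ f]) (rule inv)
    define u where "u = \<one> \<ominus> e"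
    have u: "u \<in> carrier R"
      using e by (simp add: u_def)
    have uu: "u \<otimes> u = u"
      using e by (simp add: u_def minus_eq l_distr r_distr l_minus r_minus r_neg)
    have ue: "u \<oplus> e = \<one>"
      using e(1) by (simp add: u_def minus_eq a_assoc l_neg)
    have eu: "e \<otimes> u = \<zero>"
      using e by (simp add: u_def minus_eq r_distr r_minus r_neg)
    have "u \<otimes> h = h \<otimes> u \<otimes> h" if h: "h \<in> carrier R" "h \<otimes> h = h" for h
    proof -
      have "h \<otimes> u \<otimes> h = h \<otimes> h \<oplus> \<ominus> (h \<otimes> e \<otimes> h)"
        using e h(1) by (simp add: u_def minus_eq r_distr l_distr l_minus r_minus)
      also have "\<dots> = h \<oplus> \<ominus> (e \<otimes> h)"
        unfolding h(2) inv[OF h] ..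
      also have "\<dots> = u \<otimes> h"
        using e h(1) by (simp add: u_def minus_eq l_distr l_minus)
      finally show ?thesis ..
    qed
    then have fu: "f \<otimes> u = u \<otimes> f \<otimes> u"
      using idempotent_semicentral[OF u uu _ f] by blast
    have "e \<otimes> (f \<otimes> u) = e \<otimes> (u \<otimes> f \<otimes> u)"
      by (rule arg_cong[OF fu])
    also have "\<dots> = e \<otimes> u \<otimes> (f \<otimes> u)"
      using e(1) f u by (simp add: m_assoc)
    finally have efu: "e \<otimes> (f \<otimes> u) = \<zero>"
      using f u by (simp add: eu)
    have "e \<otimes> f = e \<otimes> f \<otimes> (u \<oplus> e)"
      using e(1) f by (simp add: ue)
    also have "\<dots> = e \<otimes> (f \<otimes> u) \<oplus> e \<otimes> f \<otimes> e"
      using e(1) f u by (simp add: r_distr m_assoc)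
    also have "\<dots> = e \<otimes> f \<otimes> e"
      using e(1) f efu by simp
    also have "\<dots> = f \<otimes> e"
      by (rule fe[symmetric])
    finally show ?thesis .
  qed
  then show ?thesis
    unfolding ring_center_def using e(1) by blast
qed

context right_module
begin

lemma End_ring_group_hom:
  assumes "f \<in> carrier (End_ring R M)"
  shows "group_hom (add_monoid M) (add_monoid M) f"
  using assms
  by (auto simp: group_hom_def group_hom_axioms_def hom_def End_ring_def M.a_group)

lemma right_submodule_image:
  assumes f: "f \<in> carrier (End_ring R M)"
  shows "right_submodule (f ` carrier M) R M"
proof -
  interpret group_hom "add_monoid M" "add_monoid M" f
    using f by (rule End_ring_group_hom)
  have "f x \<odot>\<^sub>r\<^bsub>M\<^esub> a \<in> f ` carrier M" if "x \<in> carrier M" "a \<in> carrier R" for x a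
    using f that by (intro image_eqI[of _ _ "x \<odot>\<^sub>r\<^bsub>M\<^esub> a"]) (auto simp: End_ring_def)
  then show ?thesis
    using img_is_subgroup by (auto simp: right_submodule_def right_submodule_axioms_def)
qed

lemma right_submodule_kernel:
  assumes f: "f \<in> carrier (End_ring R M)"
  shows "right_submodule {x \<in> carrier M. f x = \<zero>\<^bsub>M\<^esub>} R M"
proof -
  interpret group_hom "add_monoid M" "add_monoid M" f
    using f by (rule End_ring_group_hom)
  show ?thesis
    using subgroup_kernel f
    by (auto simp: right_submodule_def right_submodule_axioms_def kernel_def End_ring_def zero_rsmult)
qed

text \<open>
  Distributivity is used for the pair \<open>X\<close>, \<open>K\<close>: it lets the equation \<open>e x = x + (e x - x)\<close> be
  replaced by one whose \<open>K\<close>-summand also lies in the image of \<open>e\<close>, and so vanishes.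
\<close>

lemma distributive_image_imp_invariant:
  assumes e: "e \<in> carrier (End_ring R M)" and idem: "\<And>x. x \<in> carrier M \<Longrightarrow> e (e x) = e x"
    and dist: "distributive_submodule (e ` carrier M) R M"
    and X: "right_submodule X R M"
  shows "e ` X \<subseteq> X"
proof
  interpret group_hom "add_monoid M" "add_monoid M" e
    using e by (rule End_ring_group_hom)
  interpret X: right_submodule X R M by (fact X)
  let ?K = "{x \<in> carrier M. e x = \<zero>\<^bsub>M\<^esub>}"
  fix y assume "y \<in> e ` X"
  then obtain x where x: "x \<in> X" "y = e x" by blast
  have xM: "x \<in> carrier M" and exM: "e x \<in> carrier M"
    using x X.subset e by (auto simp: End_ring_def)
  define k where "k = e x \<ominus>\<^bsub>M\<^esub> x"
  have "e k = e (e x) \<oplus>\<^bsub>M\<^esub> \<ominus>\<^bsub>M\<^esub> (e x)"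
    using xM exM hom_mult[of "e x" "\<ominus>\<^bsub>M\<^esub> x"] hom_inv[of x]
    by (simp add: k_def M.minus_eq a_inv_def)
  then have k: "k \<in> ?K"
    using xM exM idem by (simp add: k_def M.r_neg)
  have "e x = x \<oplus>\<^bsub>M\<^esub> k"
    using xM exM by (simp add: k_def M.minus_eq M.a_comm[of "e x"] M.r_neg2)
  then have "e x \<in> X <+>\<^bsub>M\<^esub> ?K"
    unfolding set_add_def set_mult_def using x k by auto
  then have "e x \<in> (X <+>\<^bsub>M\<^esub> ?K) \<inter> e ` carrier M"
    using xM by simp
  also have "\<dots> = (X \<inter> e ` carrier M) <+>\<^bsub>M\<^esub> (?K \<inter> e ` carrier M)"
    using dist X right_submodule_kernel[OF e] by (simp add: distributive_submodule_def)
  finally obtain z l where z: "z \<in> X" and l: "l \<in> ?K \<inter> e ` carrier M"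
    and ex: "e x = z \<oplus>\<^bsub>M\<^esub> l"
    by (auto simp: set_add_def set_mult_def)
  have "l = \<zero>\<^bsub>M\<^esub>"
    using l idem by auto
  then have "e x = z"
    using ex z X.subset by auto
  then show "y \<in> X"
    using x z by simp
qed

lemma invariant_imp_distributive_image:
  assumes e: "e \<in> carrier (End_ring R M)" and idem: "\<And>x. x \<in> carrier M \<Longrightarrow> e (e x) = e x"
    and inv: "\<And>X. right_submodule X R M \<Longrightarrow> e ` X \<subseteq> X"
  shows "distributive_submodule (e ` carrier M) R M"
  unfolding distributive_submodule_def
proof (intro conjI allI impI equalityI subsetI)
  show N: "right_submodule (e ` carrier M) R M"
    using e by (rule right_submodule_image)
  fix Y1 Y2 n
  assume Y1: "right_submodule Y1 R M" and Y2: "right_submodule Y2 R M"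
  interpret N: right_submodule "e ` carrier M" R M by (fact N)
  interpret Y1: right_submodule Y1 R M by (fact Y1)
  interpret Y2: right_submodule Y2 R M by (fact Y2)
  show "n \<in> (Y1 \<inter> e ` carrier M) <+>\<^bsub>M\<^esub> (Y2 \<inter> e ` carrier M)"
    if n: "n \<in> (Y1 <+>\<^bsub>M\<^esub> Y2) \<inter> e ` carrier M"
  proof -
    obtain y1 y2 where y: "y1 \<in> Y1" "y2 \<in> Y2" "n = y1 \<oplus>\<^bsub>M\<^esub> y2"
      using n by (auto simp: set_add_def set_mult_def)
    have yM: "y1 \<in> carrier M" "y2 \<in> carrier M"
      using y Y1.subset Y2.subset by auto
    have "n = e n"
      using n idem by auto
    also have "\<dots> = e y1 \<oplus>\<^bsub>M\<^esub> e y2"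
      using e y yM by (simp add: End_ring_def)
    finally have "n = e y1 \<oplus>\<^bsub>M\<^esub> e y2" .
    moreover have "e y1 \<in> Y1 \<inter> e ` carrier M" "e y2 \<in> Y2 \<inter> e ` carrier M"
      using y yM inv[OF Y1] inv[OF Y2] by auto
    ultimately show ?thesis
      unfolding set_add_def set_mult_def by auto
  qed
  show "n \<in> (Y1 <+>\<^bsub>M\<^esub> Y2) \<inter> e ` carrier M"
    if "n \<in> (Y1 \<inter> e ` carrier M) <+>\<^bsub>M\<^esub> (Y2 \<inter> e ` carrier M)"
    using that N.m_closed by (fastforce simp: set_add_def set_mult_def)
qed

lemma invariant_imp_central:
  assumes e: "e \<in> carrier (End_ring R M)" "e \<otimes>\<^bsub>End_ring R M\<^esub> e = e"
    and inv: "\<And>X. right_submodule X R M \<Longrightarrow> e ` X \<subseteq> X"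
  shows "e \<in> ring_center (End_ring R M)"
proof -
  interpret E: ring "End_ring R M" by (rule End_ring_is_ring)
  show ?thesis
  proof (rule E.idempotent_central[OF e])
    fix h assume h: "h \<in> carrier (End_ring R M)" and hh: "h \<otimes>\<^bsub>End_ring R M\<^esub> h = h"
    have idem: "h (h x) = h x" if "x \<in> carrier M" for x
      using fun_cong[OF hh, of x] that by (simp add: End_ring_def compose_def)
    \<comment> \<open>An idempotent fixes its image pointwise, and \<open>e\<close> maps that image into itself.\<close>
    have "h (e (h x)) = e (h x)" if x: "x \<in> carrier M" for x
    proof -
      obtain z where "z \<in> carrier M" "e (h x) = h z"
        using inv[OF right_submodule_image[OF h]] x by blast
      then show ?thesis
        using idem by simp
    qed
    then show "e \<otimes>\<^bsub>End_ring R M\<^esub> h = h \<otimes>\<^bsub>End_ring R M\<^esub> e \<otimes>\<^bsub>End_ring R M\<^esub> h"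
      using h by (auto simp: End_ring_def compose_def PiE_iff intro!: restrict_ext)
  qed
qed

end

theorem theorem3p11:
  fixes R :: "('a, 'r) ring_scheme"
    and M :: "('a, 'b, 'm) right_module_scheme"
    and N :: "'b set"
    and e :: "'b \<Rightarrow> 'b"
  assumes "right_module R M"
    and "direct_summand N R M"
    and "e \<in> carrier (End_ring R M)"
    and "e \<otimes>\<^bsub>End_ring R M\<^esub> e = e"
    and "e ` carrier M = N"
  shows "complemented_distributive_submodule N R M \<longleftrightarrow>
    e \<in> ring_center (End_ring R M) \<and> (\<forall>X. right_submodule X R M \<longrightarrow> e ` X \<subseteq> X)"
proof -
  interpret right_module R M by (fact assms(1))
  have idem: "e (e x) = e x" if "x \<in> carrier M" for x
    using fun_cong[OF assms(4), of x] that by (simp add: End_ring_def compose_def)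
  have "distributive_submodule N R M \<longleftrightarrow> (\<forall>X. right_submodule X R M \<longrightarrow> e ` X \<subseteq> X)"
    using distributive_image_imp_invariant[OF assms(3) idem]
      invariant_imp_distributive_image[OF assms(3) idem] assms(5) by metis
  then show ?thesis
    using assms(2) invariant_imp_central[OF assms(3,4)]
    by (auto simp: complemented_distributive_submodule_def)
qed

end
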